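(* Let $\ell \geq 1$ be an integer, let $G$ be a graph on $n$ vertices, let $(L,H,R)$ be an excellent partition of $V(G)$, and let $(I,O)$ be a partition of $H \cup R$. If at most $\frac{|L|}{10}$ vertices in $R$ have degree less than $10\ell$ in $G$, then there are at most $2^{|L|}\cdot 2^{-\frac{|L|}{10}}$ minimal $(I,O)$-extensions. Further, the family of all minimal $(I,O)$-extensions can be enumerated in time $2^{|L|}\cdot 2^{-\frac{|L|}{10}}\cdot n^{\mathcal{O}(1)}$.
   Context: All graphs are finite and simple. For the fixed integer $\ell$, a partition $(L,H,R)$ of $V(G)$ is a good partition if $|L| \geq 10|H|$, $L$ is an independent set, and every vertex of $L$ has fewer than $\ell$ neighbors in $R$; it is an excellent partition if moreover $G[H \cup R]$ has no edges. A vertex set $X$ is a connected dominating set of $G$ if every vertex not in $X$ has a neighbor in $X$ and $G[X]$ is connected. For disjoint vertex sets $I$ and $O$, an $(I,O)$-extension is a vertex set $S$ disjoint from $I \cup O$ such that $I \cup S$ is a connected dominating set of $G$; it is minimal if no proper subset of it is also an $(I,O)$-extension. *)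

theory Defs
  imports Complex_Main "Graph_Theory.Graph_Theory"
begin

section \<open>Graphs, partitions and extensions\<close>

text \<open>
  A finite simple graph is a \<^term>\<open>G\<close> with \<^term>\<open>pair_graph G\<close>: finite, loop-free, with a
  symmetric arc set, so an edge \<open>uv\<close> is the pair of arcs \<open>(u, v)\<close>, \<open>(v, u)\<close>.
\<close>

definition neighbors :: "'a pair_pre_digraph \<Rightarrow> 'a \<Rightarrow> 'a set" where
  "neighbors G v = {w. (v, w) \<in> parcs G}"

definition degree :: "'a pair_pre_digraph \<Rightarrow> 'a \<Rightarrow> nat" where
  "degree G v = card (neighbors G v)"

definition independent_set :: "'a pair_pre_digraph \<Rightarrow> 'a set \<Rightarrow> bool" where
  "independent_set G X \<longleftrightarrow> X \<subseteq> pverts G \<and> (\<forall>u\<in>X. \<forall>v\<in>X. (u, v) \<notin> parcs G)"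

definition good_partition ::
  "nat \<Rightarrow> 'a pair_pre_digraph \<Rightarrow> 'a set \<Rightarrow> 'a set \<Rightarrow> 'a set \<Rightarrow> bool" where
  "good_partition l G L H R \<longleftrightarrow>
     L \<union> H \<union> R = pverts G \<and> L \<inter> H = {} \<and> L \<inter> R = {} \<and> H \<inter> R = {} \<and>
     card L \<ge> 10 * card H \<and>
     independent_set G L \<and>
     (\<forall>v\<in>L. card (neighbors G v \<inter> R) < l)"

definition excellent_partition ::
  "nat \<Rightarrow> 'a pair_pre_digraph \<Rightarrow> 'a set \<Rightarrow> 'a set \<Rightarrow> 'a set \<Rightarrow> bool" where
  "excellent_partition l G L H R \<longleftrightarrow>
     good_partition l G L H R \<and> arcs (with_proj G \<restriction> (H \<union> R)) = {}"

text \<open>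
  The library's notion of connectedness excludes the empty graph; here this matters only if
  \<^term>\<open>G\<close> itself has no vertices.
\<close>

definition connected_dominating_set :: "'a pair_pre_digraph \<Rightarrow> 'a set \<Rightarrow> bool" where
  "connected_dominating_set G X \<longleftrightarrow>
     X \<subseteq> pverts G \<and>
     (\<forall>v \<in> pverts G - X. neighbors G v \<inter> X \<noteq> {}) \<and>
     Digraph_Component.connected (with_proj G \<restriction> X)"

definition extension :: "'a pair_pre_digraph \<Rightarrow> 'a set \<Rightarrow> 'a set \<Rightarrow> 'a set \<Rightarrow> bool" where
  "extension G In Out S \<longleftrightarrow>
     S \<subseteq> pverts G \<and> S \<inter> (In \<union> Out) = {} \<and> connected_dominating_set G (In \<union> S)"

definition minimal_extension :: "'a pair_pre_digraph \<Rightarrow> 'a set \<Rightarrow> 'a set \<Rightarrow> 'a set \<Rightarrow> bool" where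
  "minimal_extension G In Out S \<longleftrightarrow>
     extension G In Out S \<and> (\<forall>S'. S' \<subset> S \<longrightarrow> \<not> extension G In Out S')"


section \<open>Computation model\<close>

text \<open>
  Programs of pure first-order LISP, evaluated call by value on binary trees; the running time is
  the number of evaluation steps. Every step is a constant number of pointer operations, so a
  random access machine simulates it in constant time (time logarithmic in the running time,
  under logarithmic cost), and conversely a random access machine running for \<open>T\<close> steps is
  simulated with an overhead polynomial in \<open>log T\<close>. Hence a bound \<open>2^(9|L|/10) n^O(1)\<close>
  means the same in both models.

  A program is the list of its function bodies: \<open>App f es\<close> calls the \<open>f\<close>-th one, in which
  \<open>Var i\<close> refers to the \<open>i\<close>-th argument. Evaluation is stuck on an unbound variable, an
  undefined function and the \<open>FstE\<close> or \<open>SndE\<close> of a leaf.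
\<close>

datatype btree = Leaf | Node btree btree

datatype expr =
    Var nat
  | NilE
  | PairE expr expr
  | FstE expr
  | SndE expr
  | IfE expr expr expr
  | App nat "expr list"

type_synonym program = "expr list"

inductive
  evalto :: "program \<Rightarrow> btree list \<Rightarrow> expr \<Rightarrow> btree \<Rightarrow> nat \<Rightarrow> bool" and
  evalsto :: "program \<Rightarrow> btree list \<Rightarrow> expr list \<Rightarrow> btree list \<Rightarrow> nat \<Rightarrow> bool"
  for P :: program
where
  evalto_Var: "i < length env \<Longrightarrow> evalto P env (Var i) (env ! i) 1"
| evalto_Nil: "evalto P env NilE Leaf 1"
| evalto_Pair: "evalto P env e1 x s \<Longrightarrow> evalto P env e2 y t \<Longrightarrow>
    evalto P env (PairE e1 e2) (Node x y) (s + t + 1)"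
| evalto_Fst: "evalto P env e (Node x y) t \<Longrightarrow> evalto P env (FstE e) x (t + 1)"
| evalto_Snd: "evalto P env e (Node x y) t \<Longrightarrow> evalto P env (SndE e) y (t + 1)"
| evalto_If_Node: "evalto P env e (Node x y) s \<Longrightarrow> evalto P env e1 z t \<Longrightarrow>
    evalto P env (IfE e e1 e2) z (s + t + 1)"
| evalto_If_Leaf: "evalto P env e Leaf s \<Longrightarrow> evalto P env e2 z t \<Longrightarrow>
    evalto P env (IfE e e1 e2) z (s + t + 1)"
| evalto_App: "f < length P \<Longrightarrow> evalsto P env es xs s \<Longrightarrow> evalto P xs (P ! f) z t \<Longrightarrow>
    evalto P env (App f es) z (s + t + 1)"
| evalsto_Nil: "evalsto P env [] [] 0"
| evalsto_Cons: "evalto P env e x s \<Longrightarrow> evalsto P env es xs t \<Longrightarrow>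
    evalsto P env (e # es) (x # xs) (s + t)"

lemma evalto_deterministic:
  "evalto P env e x s \<Longrightarrow> evalto P env e y t \<Longrightarrow> x = y \<and> s = t"
  "evalsto P env es xs s \<Longrightarrow> evalsto P env es ys t \<Longrightarrow> xs = ys \<and> s = t"
proof (induction arbitrary: y t and ys t rule: evalto_evalsto.inducts)
  case (evalto_Var i env)
  then show ?case by (auto elim: evalto.cases)
next
  case (evalto_Nil env)
  then show ?case by (auto elim: evalto.cases)
next
  case (evalto_Pair env e1 x s e2 y t)
  from evalto_Pair.prems show ?case
    by cases (use evalto_Pair.IH in blast)
next
  case (evalto_Fst env e x y t)
  from evalto_Fst.prems show ?case
    by cases (use evalto_Fst.IH in blast)
next
  case (evalto_Snd env e x y t)
  from evalto_Snd.prems show ?case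
    by cases (use evalto_Snd.IH in blast)
next
  case (evalto_If_Node env e x y s e1 z t e2)
  from evalto_If_Node.prems show ?case
    by cases (use evalto_If_Node.IH in blast)+
next
  case (evalto_If_Leaf env e s e2 z t e1)
  from evalto_If_Leaf.prems show ?case
    by cases (use evalto_If_Leaf.IH in blast)+
next
  case (evalto_App f env es xs s z t)
  from evalto_App.prems show ?case
    by cases (use evalto_App.IH in blast)
next
  case (evalsto_Nil env)
  then show ?case by (auto elim: evalsto.cases)
next
  case (evalsto_Cons env e x s es xs t)
  from evalsto_Cons.prems show ?case
    by cases (use evalsto_Cons.IH in blast)
qed

definition computes_in_time :: "program \<Rightarrow> btree \<Rightarrow> btree \<Rightarrow> nat \<Rightarrow> bool" where
  "computes_in_time P x y t \<longleftrightarrow> evalto P [x] (App 0 [Var 0]) y t"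

text \<open>
  A graph with vertex set \<open>{0, \<dots>, n - 1}\<close> is passed as its adjacency matrix, and a set of
  vertices as its characteristic bit vector of length \<open>n\<close>.
\<close>

primrec enc_list :: "btree list \<Rightarrow> btree" where
  "enc_list [] = Leaf"
| "enc_list (x # xs) = Node x (enc_list xs)"

definition enc_bool :: "bool \<Rightarrow> btree" where
  "enc_bool b = (if b then Node Leaf Leaf else Leaf)"

definition enc_set :: "nat \<Rightarrow> nat set \<Rightarrow> btree" where
  "enc_set n X = enc_list (map (\<lambda>v. enc_bool (v \<in> X)) [0..<n])"

definition enc_graph :: "nat \<Rightarrow> nat pair_pre_digraph \<Rightarrow> btree" where
  "enc_graph n G = enc_list (map (\<lambda>v. enc_set n (neighbors G v)) [0..<n])"

definition enc_instance ::
  "nat \<Rightarrow> nat pair_pre_digraph \<Rightarrow> nat set \<Rightarrow> nat set \<Rightarrow> nat set \<Rightarrow> nat set \<Rightarrow> nat set \<Rightarrow> btree" where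
  "enc_instance n G L H R In Out =
     enc_list (enc_graph n G # map (enc_set n) [L, H, R, In, Out])"

text \<open>The members of the family are listed in arbitrary order, each exactly once.\<close>

definition enumerates_in_time :: "program \<Rightarrow> nat \<Rightarrow> btree \<Rightarrow> nat set set \<Rightarrow> nat \<Rightarrow> bool" where
  "enumerates_in_time P n x F t \<longleftrightarrow>
     (\<exists>Ss. distinct Ss \<and> set Ss = F \<and>
        computes_in_time P x (enc_list (map (enc_set n) Ss)) t)"

end

theory Submission
  imports Defs
begin

text \<open>
  The graph is bipartite with sides \<open>L\<close> and \<open>H \<union> R\<close>. Counting the edges between \<open>L\<close> and \<open>R\<close> shows
  that at most \<open>|L|/10\<close> vertices of \<open>R\<close> have degree at least \<open>10 l\<close>, so \<open>|H \<union> R| \<le> 3|L|/10\<close>. A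
  minimal extension \<open>S\<close> is contained in \<open>L\<close>; fewer than \<open>|In|\<close> of its vertices connect \<open>In\<close>, and at
  most \<open>|Out|\<close> further ones dominate \<open>Out\<close>, while \<open>In\<close> dominates \<open>L\<close>. Hence \<open>|S| \<le> |H \<union> R|\<close>,
  apart from the one-vertex graph. The number of subsets of \<open>L\<close> of size at most \<open>k\<close> is bounded by
  \<open>2 ^ k (3/2) ^ |L|\<close>, which for \<open>k = 3|L|/10\<close> is at most \<open>2 ^ (9|L|/10)\<close>. The program lists these
  subsets and keeps the minimal extensions; as extensions are closed under adding vertices of \<open>L\<close>,
  minimality is tested by deleting single vertices.
\<close>

subsection \<open>Connected vertex sets\<close>

text \<open>Connectedness of an induced subgraph, restated as reachability inside \<open>X\<close>
  for a bare relation; nonemptiness matches the library's notion.\<close>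

definition linked :: "'a rel \<Rightarrow> 'a set \<Rightarrow> bool" where
  "linked E X \<longleftrightarrow> X \<noteq> {} \<and> (\<forall>u\<in>X. \<forall>v\<in>X. (u, v) \<in> rtrancl_on X E)"

lemma linked_singleton: "linked E {x}"
  by (simp add: linked_def)

text \<open>Each vertex of \<open>Z - Y\<close> steps into \<open>Y\<close>, and symmetry gives the
  way back. Connected sets are grown with this rule throughout.\<close>

lemma linked_superset:
  assumes "sym E" "linked E Y" "Y \<subseteq> Z" "\<And>z. z \<in> Z - Y \<Longrightarrow> \<exists>y\<in>Y. (z, y) \<in> E"
  shows "linked E Z"
proof -
  have reach: "\<exists>y\<in>Y. (z, y) \<in> rtrancl_on Z E" if "z \<in> Z" for z
  proof (cases "z \<in> Y")
    case True
    then show ?thesis using assms(3) by auto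
  next
    case False
    then obtain y where "y \<in> Y" "(z, y) \<in> E" using assms(4) \<open>z \<in> Z\<close> by blast
    moreover from this have "(z, y) \<in> rtrancl_on Z E"
      using converse_rtrancl_on_into_rtrancl_on[of z y E y Z] assms(3) that by auto
    ultimately show ?thesis by blast
  qed
  have "(u, v) \<in> rtrancl_on Z E" if uv: "u \<in> Z" "v \<in> Z" for u v
  proof -
    obtain a b where ab: "a \<in> Y" "b \<in> Y" "(u, a) \<in> rtrancl_on Z E" "(v, b) \<in> rtrancl_on Z E"
      using reach uv by blast
    have "(b, v) \<in> rtrancl_on Z E"
      using rtrancl_on_sym[OF assms(1)] ab(4) by (rule symD)
    moreover have "(a, b) \<in> rtrancl_on Z E"
      using assms(2,3) ab by (auto simp: linked_def intro: rtrancl_on_mono[OF subset_refl])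
    ultimately show ?thesis using ab(3) by (blast intro: rtrancl_on_trans)
  qed
  then show ?thesis using assms(2,3) by (auto simp: linked_def)
qed

text \<open>Otherwise no edge inside \<open>X\<close> leaves \<open>A\<close>, and a walk from
  \<open>A\<close> to a vertex of \<open>X - A\<close> could not exist.\<close>

lemma linked_crossing_edge:
  assumes "linked E X" "A \<subseteq> X" "A \<noteq> {}" "A \<noteq> X"
  obtains u v where "u \<in> A" "v \<in> X - A" "(u, v) \<in> E"
proof (rule ccontr)
  assume "\<not> thesis"
  with that have closed: "v \<in> A" if "u \<in> A" "v \<in> X" "(u, v) \<in> E" for u v
    using that by blast
  obtain a where a: "a \<in> A" using assms by blast
  obtain b where b: "b \<in> X" "b \<notin> A" using assms by blast
  have "(a, b) \<in> rtrancl_on X E"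
    using assms a b by (auto simp: linked_def)
  then have "b \<in> A"
    by (induction rule: rtrancl_on_induct) (auto intro: a closed)
  with b show False by simp
qed

text \<open>
  In a bipartite graph, a side \<open>A\<close> is connected greedily: as long as the part \<open>B\<close> of \<open>A\<close> reached so
  far is proper, an edge leaving \<open>B\<close> and its neighbours must end in \<open>A\<close>, so one more vertex of the
  other side suffices to reach one more vertex of \<open>A\<close>.
\<close>

lemma linked_skeleton:
  assumes "sym E" "finite A" "A \<noteq> {}" "linked E (A \<union> S)"
    and "\<And>u v. u \<in> A \<Longrightarrow> v \<in> A \<Longrightarrow> (u, v) \<notin> E"
    and "\<And>u v. u \<in> S \<Longrightarrow> v \<in> S \<Longrightarrow> (u, v) \<notin> E"
  obtains T where "finite T" "T \<subseteq> S" "card T < card A" "linked E (A \<union> T)"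
proof -
  have "\<exists>B T. B \<subseteq> A \<and> card B = k \<and> finite T \<and> T \<subseteq> S \<and> card T < k \<and> linked E (B \<union> T)"
    if "1 \<le> k" "k \<le> card A" for k
    using that
  proof (induction k rule: dec_induct)
    case base
    obtain a where "a \<in> A" using assms by blast
    then show ?case
      by (intro exI[of _ "{a}"] exI[of _ "{}"]) (auto simp: linked_singleton)
  next
    case (step k)
    then obtain B T where BT: "B \<subseteq> A" "card B = k" "finite T" "T \<subseteq> S" "card T < k"
      "linked E (B \<union> T)" by auto
    define C where "C = B \<union> {s \<in> S. \<exists>b\<in>B. (b, s) \<in> E}"
    obtain a where a: "a \<in> A" "a \<notin> B"
      using BT step by (metis Suc_n_not_le_n subsetI subset_antisym)
    have "a \<notin> C" using a assms(5) BT(1) by (auto simp: C_def)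
    then have "C \<noteq> A \<union> S" using a(1) by blast
    moreover have "C \<subseteq> A \<union> S" using BT(1) by (auto simp: C_def)
    moreover have "C \<noteq> {}" using BT(2) step.hyps by (auto simp: C_def)
    ultimately obtain u v where uv: "u \<in> C" "v \<in> (A \<union> S) - C" "(u, v) \<in> E"
      using linked_crossing_edge[OF assms(4), of C] by blast
    \<comment> \<open>Inside \<open>A \<union> S\<close>, edges from \<open>B\<close> end in
      \<open>S\<close>, hence in \<open>C\<close>. So \<open>u\<close> is a neighbour of
      \<open>B\<close> in \<open>S\<close>, and \<open>v\<close> lies in \<open>A\<close> because
      \<open>S\<close> is independent.\<close>
    have v: "v \<in> A" "v \<notin> B" and u: "u \<in> S" "\<exists>b\<in>B. (b, u) \<in> E"
      using uv assms(5,6) BT(1) by (auto simp: C_def)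
    have "linked E (insert u (B \<union> T))"
      by (rule linked_superset[OF assms(1) BT(6)]) (use u assms(1) in \<open>auto dest: symD\<close>)
    then have "linked E (insert v (insert u (B \<union> T)))"
      by (rule linked_superset[OF assms(1)]) (use uv assms(1) in \<open>auto dest: symD\<close>)
    then have "linked E (insert v B \<union> insert u T)" by (simp add: insert_commute)
    moreover have "card (insert v B) = Suc k"
      using v BT assms(2) finite_subset by fastforce
    moreover have "card (insert u T) < Suc k"
      using BT by (simp add: card_insert_if)
    ultimately show ?case
      using BT v u by (intro exI[of _ "insert v B"] exI[of _ "insert u T"]) simp
  qed
  from this[of "card A"] obtain B T where
    "B \<subseteq> A" "card B = card A" "finite T" "T \<subseteq> S" "card T < card A" "linked E (B \<union> T)"
    using assms(2,3) by (auto simp: Suc_le_eq card_gt_0_iff)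
  then show thesis using that card_subset_eq[OF assms(2)] by metis
qed

section \<open>Connected dominating sets in terms of reachability\<close>

text \<open>The library symmetrizes the arcs of the induced subgraph. As \<open>parcs G\<close> is
  symmetric, the result lies between \<open>parcs G \<inter> X \<times> X\<close> and
  \<open>parcs G\<close>, and these give the same walks inside \<open>X\<close>.\<close>

lemma connected_induced_iff_linked:
  assumes "sym (parcs G)"
  shows "Digraph_Component.connected (with_proj G \<restriction> X) \<longleftrightarrow> linked (parcs G) X"
proof -
  let ?F = "parcs (mk_symmetric (with_proj G \<restriction> X))"
  have "?F \<subseteq> parcs G" "parcs G \<inter> X \<times> X \<subseteq> ?F"
    using assms by (auto simp: parcs_mk_symmetric dest: symD)
  then have "(u, v) \<in> rtrancl_on X ?F \<longleftrightarrow> (u, v) \<in> rtrancl_on X (parcs G)" for u v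
  proof (intro iffI)
    assume "(u, v) \<in> rtrancl_on X (parcs G)"
    then show "(u, v) \<in> rtrancl_on X ?F"
      by (induction rule: rtrancl_on_induct)
        (use \<open>parcs G \<inter> X \<times> X \<subseteq> ?F\<close> in \<open>auto intro: rtrancl_on_into_rtrancl_on\<close>)
  qed (auto intro: rtrancl_on_mono)
  then show ?thesis
    by (simp add: connected_def strongly_connected_def reachable_def linked_def)
qed

lemma pair_graph_sym: "pair_graph G \<Longrightarrow> sym (parcs G)"
  by (auto intro!: symI dest: pair_sym_digraph.arcs_symmetric[rotated]
      simp: pair_graph_def pair_pseudo_graph_def)

lemma pair_graph_finite: "pair_graph G \<Longrightarrow> finite (pverts G)"
  by (simp add: pair_graph_def pair_digraph_def pair_fin_digraph_def pair_fin_digraph_axioms_def)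

lemma connected_dominating_set_linked:
  assumes "pair_graph G"
  shows "connected_dominating_set G X \<longleftrightarrow>
     X \<subseteq> pverts G \<and> (\<forall>v \<in> pverts G - X. neighbors G v \<inter> X \<noteq> {}) \<and> linked (parcs G) X"
  by (simp add: connected_dominating_set_def
      connected_induced_iff_linked[OF pair_graph_sym[OF assms]])

text \<open>An added vertex has a neighbour in \<open>X\<close> by domination, so it can be attached
  to the connected set.\<close>

lemma connected_dominating_set_mono:
  assumes "pair_graph G" "connected_dominating_set G X" "X \<subseteq> Y" "Y \<subseteq> pverts G"
  shows "connected_dominating_set G Y"
proof -
  note cds = assms(2)[unfolded connected_dominating_set_linked[OF assms(1)]]
  have "linked (parcs G) Y"
    by (rule linked_superset[OF pair_graph_sym[OF assms(1)] _ assms(3)])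
      (use cds assms(4) in \<open>auto simp: neighbors_def\<close>)
  then show ?thesis
    using cds assms by (fastforce simp: connected_dominating_set_linked)
qed

subsection \<open>Minimal extensions\<close>

text \<open>A smaller extension misses some \<open>v\<close> of \<open>S\<close>, and by
  monotonicity \<open>S - {v}\<close> is then an extension too.\<close>

lemma minimal_extension_iff:
  assumes "pair_graph G"
  shows "minimal_extension G In Out S \<longleftrightarrow>
    extension G In Out S \<and> (\<forall>v\<in>S. \<not> extension G In Out (S - {v}))"
proof (intro iffI conjI ballI)
  assume ext: "extension G In Out S \<and> (\<forall>v\<in>S. \<not> extension G In Out (S - {v}))"
  show "minimal_extension G In Out S"
    unfolding minimal_extension_def
  proof (intro conjI allI impI notI)
    fix S' assume S': "S' \<subset> S" "extension G In Out S'"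
    then obtain v where v: "v \<in> S" "v \<notin> S'" by blast
    have "extension G In Out (S - {v})"
      unfolding extension_def
    proof (intro conjI)
      show "connected_dominating_set G (In \<union> (S - {v}))"
        by (rule connected_dominating_set_mono[OF assms, of "In \<union> S'"])
          (use S' v ext in \<open>auto simp: extension_def connected_dominating_set_def\<close>)
    qed (use ext in \<open>auto simp: extension_def\<close>)
    then show False using ext v by blast
  qed (use ext in simp)
qed (auto simp: minimal_extension_def)

lemma minimal_extension_card_le:
  assumes G: "pair_graph G"
    and V: "pverts G = L \<union> In \<union> Out" and L: "L \<inter> (In \<union> Out) = {}"
    and indL: "\<And>u v. u \<in> L \<Longrightarrow> v \<in> L \<Longrightarrow> (u, v) \<notin> parcs G"
    and indIO: "\<And>u v. u \<in> In \<union> Out \<Longrightarrow> v \<in> In \<union> Out \<Longrightarrow> (u, v) \<notin> parcs G"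
    and disj: "In \<inter> Out = {}"
    and S: "minimal_extension G In Out S"
  shows "S \<subseteq> L" "card S \<le> max 1 (card (In \<union> Out))"
proof -
  have ext: "extension G In Out S" using S by (simp add: minimal_extension_def)
  then show SL: "S \<subseteq> L" using V by (auto simp: extension_def)
  have fin: "finite L" "finite In" "finite Out"
    using pair_graph_finite[OF G] V by auto
  note sym = pair_graph_sym[OF G]
  have dom: "\<And>v. v \<in> pverts G \<Longrightarrow> v \<notin> In \<union> S \<Longrightarrow> \<exists>w \<in> In \<union> S. (v, w) \<in> parcs G"
    and linked: "linked (parcs G) (In \<union> S)"
    using ext by (auto simp: extension_def connected_dominating_set_linked[OF G] neighbors_def)
  show "card S \<le> max 1 (card (In \<union> Out))"
  proof (cases "In = {}")
    \<comment> \<open>Without \<open>In\<close>, the set \<open>S\<close> is connected and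
      independent, hence a single vertex; the 1 in the maximum is for this case.\<close>
    case True
    obtain s where s: "s \<in> S" using linked True by (auto simp: linked_def)
    have "S = {s}"
    proof (rule ccontr)
      assume "S \<noteq> {s}"
      then obtain u v where "u \<in> {s}" "v \<in> S - {s}" "(u, v) \<in> parcs G"
        using linked_crossing_edge[of "parcs G" S "{s}"] linked True s by auto
      then show False using indL SL s by auto
    qed
    then show ?thesis by simp
  next
    case False
    obtain T where T: "finite T" "T \<subseteq> S" "card T < card In" "linked (parcs G) (In \<union> T)"
    proof (rule linked_skeleton[OF sym fin(2) False linked])
      show "(u, v) \<notin> parcs G" if "u \<in> In" "v \<in> In" for u v using that indIO by simp
      show "(u, v) \<notin> parcs G" if "u \<in> S" "v \<in> S" for u v using that indL SL by auto
    qed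
    have "\<exists>s\<in>S. (w, s) \<in> parcs G" if w: "w \<in> Out" for w
    proof -
      have "w \<in> pverts G" "w \<notin> In \<union> S" using w V disj L SL by auto
      then obtain s where "s \<in> In \<union> S" "(w, s) \<in> parcs G" using dom by blast
      then show ?thesis using indIO[of w s] w by auto
    qed
    \<comment> \<open>One dominator in \<open>S\<close> per vertex of \<open>Out\<close>: it cannot
      come from \<open>In\<close>, since \<open>In \<union> Out\<close> is independent.\<close>
    then obtain f where f: "\<And>w. w \<in> Out \<Longrightarrow> f w \<in> S \<and> (w, f w) \<in> parcs G" by metis
    define T' where "T' = T \<union> f ` Out"
    have T'S: "T' \<subseteq> S" using T f by (auto simp: T'_def)
    \<comment> \<open>A vertex of \<open>L\<close> outside \<open>S\<close> is dominated, and one in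
      \<open>S\<close> has a neighbour by connectedness; that neighbour is in \<open>In\<close> as
      \<open>L\<close> is independent. So every chosen vertex can be attached to
      \<open>In \<union> T\<close>, and \<open>T'\<close> is an extension, equal to \<open>S\<close>
      by minimality.\<close>
    have adj: "\<exists>w\<in>In. (v, w) \<in> parcs G" if v: "v \<in> L" for v
    proof -
      have "\<exists>w\<in>In \<union> S. (v, w) \<in> parcs G"
      proof (cases "v \<in> S")
        case True
        have "v \<notin> In" using v L by auto
        then have "{v} \<noteq> In \<union> S" using False by auto
        then obtain u w where "u \<in> {v}" "w \<in> In \<union> S - {v}" "(u, w) \<in> parcs G"
          using True by (auto intro: linked_crossing_edge[OF linked, of "{v}"])
        then show ?thesis by auto
      next
        case False
        have "v \<in> pverts G" "v \<notin> In \<union> S" using v V L False by auto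
        then show ?thesis using dom by blast
      qed
      then obtain w where w: "w \<in> In \<union> S" "(v, w) \<in> parcs G" by blast
      then have "w \<notin> S" using indL[OF v, of w] SL by auto
      then show ?thesis using w by auto
    qed
    have "linked (parcs G) (In \<union> T')"
    proof (rule linked_superset[OF sym T(4)])
      fix z assume "z \<in> In \<union> T' - (In \<union> T)"
      then have "z \<in> L" using T'S SL by auto
      then show "\<exists>y\<in>In \<union> T. (z, y) \<in> parcs G" using adj[of z] by auto
    qed (auto simp: T'_def)
    moreover have "neighbors G v \<inter> (In \<union> T') \<noteq> {}" if "v \<in> pverts G - (In \<union> T')" for v
    proof -
      consider "v \<in> L" | "v \<in> Out" using \<open>v \<in> pverts G - (In \<union> T')\<close> V by auto
      then show ?thesis
      proof cases
        case 1
        then show ?thesis using adj[of v] by (auto simp: neighbors_def)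
      next
        case 2
        then show ?thesis using f[of v] by (auto simp: T'_def neighbors_def)
      qed
    qed
    ultimately have "extension G In Out T'"
      unfolding extension_def connected_dominating_set_linked[OF G]
      using ext T'S by (intro conjI ballI) (auto simp: extension_def connected_dominating_set_def)
    then have "T' = S" using S T'S by (auto simp: minimal_extension_def)
    moreover have "card T' \<le> card T + card (f ` Out)"
      by (simp add: T'_def card_Un_le)
    moreover have "card (f ` Out) \<le> card Out" using fin by (simp add: card_image_le)
    ultimately show ?thesis using T disj fin by (simp add: card_Un_disjoint)
  qed
qed

section \<open>The size of \<open>H \<union> R\<close> in an excellent partition\<close>

lemma excellent_partitionD:
  assumes "excellent_partition l G L H R"
  shows "L \<union> (H \<union> R) = pverts G" "L \<inter> (H \<union> R) = {}"
    "\<And>u v. u \<in> L \<Longrightarrow> v \<in> L \<Longrightarrow> (u, v) \<notin> parcs G"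
    "\<And>u v. u \<in> H \<union> R \<Longrightarrow> v \<in> H \<union> R \<Longrightarrow> (u, v) \<notin> parcs G"
  using assms
  by (auto simp: excellent_partition_def good_partition_def independent_set_def
      induce_subgraph_def)

text \<open>Three sets, each of size at most a tenth of \<open>card L\<close>, cover
  \<open>H \<union> R\<close>: \<open>H\<close>, the low-degree vertices of \<open>R\<close>, and
  the remaining set \<open>B\<close>.\<close>

lemma excellent_partition_card:
  assumes G: "pair_graph G" and l: "l \<ge> 1" and part: "excellent_partition l G L H R"
    and low: "real (card {v \<in> R. degree G v < 10 * l}) \<le> real (card L) / 10"
  shows "10 * card (H \<union> R) \<le> 3 * card L"
proof -
  note part' = excellent_partitionD[OF part]
  have fin: "finite L" "finite H" "finite R"
    using pair_graph_finite[OF G] part'(1) by (metis finite_Un)+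
  define B where "B = {v \<in> R. degree G v \<ge> 10 * l}"
  have finB: "finite B" using fin by (simp add: B_def)
  have sym: "sym (parcs G)" by (rule pair_graph_sym[OF G])
  \<comment> \<open>\<open>H \<union> R\<close> has no inner edges, so the whole degree of
    \<open>r\<close> goes into \<open>L\<close>.\<close>
  have nb: "neighbors G r = {v \<in> L. (r, v) \<in> parcs G}" if "r \<in> R" for r
  proof -
    have "neighbors G r \<subseteq> pverts G"
      using G by (auto simp: neighbors_def pair_graph_def pair_digraph_def
          pair_fin_digraph_def dest: pair_wf_digraph.in_arcsD2)
    then show ?thesis using part' that by (auto simp: neighbors_def)
  qed
  \<comment> \<open>double counting of the edges between \<open>B\<close> and \<open>L\<close>\<close>
  have "card B * (10 * l) \<le> (\<Sum>r\<in>B. card {v \<in> L. (r, v) \<in> parcs G})"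
    by (rule sum_bounded_below[where 'a = nat, simplified])
      (auto simp: B_def degree_def nb)
  also have "\<dots> = (\<Sum>v\<in>L. card {r \<in> B. (r, v) \<in> parcs G})"
    by (rule sum_multicount_gen) (use fin finB in auto)
  also have "\<dots> \<le> (\<Sum>v\<in>L. l)"
  proof (rule sum_mono)
    fix v assume v: "v \<in> L"
    have "{r \<in> B. (r, v) \<in> parcs G} \<subseteq> neighbors G v \<inter> R"
      using sym by (auto simp: B_def neighbors_def dest: symD)
    then have "card {r \<in> B. (r, v) \<in> parcs G} \<le> card (neighbors G v \<inter> R)"
      using fin by (intro card_mono) auto
    also have "\<dots> < l"
      using part v by (auto simp: excellent_partition_def good_partition_def)
    finally show "card {r \<in> B. (r, v) \<in> parcs G} \<le> l" by simp
  qed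
  finally have "10 * card B \<le> card L" using l by simp
  moreover have "card R \<le> card B + card {v \<in> R. degree G v < 10 * l}"
    by (rule order_trans[OF _ card_Un_le], rule card_mono)
      (use fin finB in \<open>auto simp: B_def\<close>)
  moreover have "10 * card {v \<in> R. degree G v < 10 * l} \<le> card L"
    using low by linarith
  moreover have "10 * card H \<le> card L"
    using part by (auto simp: excellent_partition_def good_partition_def)
  moreover have "card (H \<union> R) \<le> card H + card R" by (rule card_Un_le)
  ultimately show ?thesis by linarith
qed

subsection \<open>Evaluation within a time bound\<close>

text \<open>Bounds instead of exact step counts, so that times may be rounded up in
  inductions.\<close>

definition evalb :: "program \<Rightarrow> btree list \<Rightarrow> expr \<Rightarrow> btree \<Rightarrow> nat \<Rightarrow> bool" where
  "evalb P env e v T \<longleftrightarrow> (\<exists>t\<le>T. evalto P env e v t)"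

definition evalsb :: "program \<Rightarrow> btree list \<Rightarrow> expr list \<Rightarrow> btree list \<Rightarrow> nat \<Rightarrow> bool" where
  "evalsb P env es vs T \<longleftrightarrow> (\<exists>t\<le>T. evalsto P env es vs t)"

text \<open>
  The branch of a conditional is judged only after the value of its condition is known; this
  makes the evaluation rules applicable by plain resolution, without backtracking.
\<close>

definition branchb ::
  "program \<Rightarrow> btree list \<Rightarrow> btree \<Rightarrow> expr \<Rightarrow> expr \<Rightarrow> btree \<Rightarrow> nat \<Rightarrow> bool" where
  "branchb P env c e1 e2 v T \<longleftrightarrow> evalb P env (if c = Leaf then e2 else e1) v T"

text \<open>A call on already evaluated arguments. The functions of the program are specified in
  this form, which \<open>evalb_App\<close> consumes.\<close>

definition callb :: "program \<Rightarrow> nat \<Rightarrow> btree list \<Rightarrow> btree \<Rightarrow> nat \<Rightarrow> bool" where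
  "callb P f xs v T \<longleftrightarrow> f < length P \<and> evalb P xs (P ! f) v T"

lemma evalb_Var:
  "evalb P (x # env) (Var 0) x 1"
  "evalb P (x # y # env) (Var 1) y 1"
  "evalb P (x # y # z # env) (Var 2) z 1"
  "evalb P (x # y # z # w # env) (Var 3) w 1"
  using evalto_Var[of 0 "x # env" P] evalto_Var[of 1 "x # y # env" P]
    evalto_Var[of 2 "x # y # z # env" P] evalto_Var[of 3 "x # y # z # w # env" P]
  by (auto simp: evalb_def)

lemma evalb_Nil: "evalb P env NilE Leaf 1"
  unfolding evalb_def using evalto_Nil by blast

lemma evalb_Pair:
  "evalb P env e1 x s \<Longrightarrow> evalb P env e2 y t \<Longrightarrow> evalb P env (PairE e1 e2) (Node x y) (s + t + 1)"
  unfolding evalb_def using evalto_Pair by (metis add_le_mono order_refl)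

lemma evalb_Fst: "evalb P env e (Node x y) t \<Longrightarrow> evalb P env (FstE e) x (t + 1)"
  unfolding evalb_def using evalto_Fst by (metis add_le_mono order_refl)

lemma evalb_Snd: "evalb P env e (Node x y) t \<Longrightarrow> evalb P env (SndE e) y (t + 1)"
  unfolding evalb_def using evalto_Snd by (metis add_le_mono order_refl)

lemma evalb_If:
  assumes "evalb P env e c s" "branchb P env c e1 e2 v t"
  shows "evalb P env (IfE e e1 e2) v (s + t + 1)"
proof (cases c)
  case Leaf
  then show ?thesis
    using assms evalto_If_Leaf[of P env e _ e2 v _ e1] unfolding evalb_def branchb_def
    by (metis add_le_mono order_refl)
next
  case (Node x y)
  then show ?thesis
    using assms evalto_If_Node[of P env e x y _ e1 v _ e2] unfolding evalb_def branchb_def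
    by (metis add_le_mono order_refl btree.distinct(1))
qed

lemma branchb_Node: "evalb P env e1 v t \<Longrightarrow> branchb P env (Node x y) e1 e2 v t"
  by (simp add: branchb_def)

lemma branchb_Leaf: "evalb P env e2 v t \<Longrightarrow> branchb P env Leaf e1 e2 v t"
  by (simp add: branchb_def)

text \<open>For a condition not known in advance both branches are run: the value remains a
  conditional, and the time is the larger one.\<close>

lemma branchb_bool:
  "(b \<Longrightarrow> evalb P env e1 v s) \<Longrightarrow> (\<not> b \<Longrightarrow> evalb P env e2 w t) \<Longrightarrow>
    branchb P env (enc_bool b) e1 e2 (if b then v else w) (max s t)"
  by (auto simp: branchb_def enc_bool_def evalb_def le_max_iff_disj)

lemma evalb_App:
  "evalsb P env es xs s \<Longrightarrow> callb P f xs v t \<Longrightarrow> evalb P env (App f es) v (s + t + 1)"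
  unfolding evalb_def evalsb_def callb_def using evalto_App by (metis add_le_mono order_refl)

lemma evalsb_Nil: "evalsb P env [] [] 0"
  by (auto simp: evalsb_def intro: evalsto_Nil)

lemma evalsb_Cons:
  "evalb P env e x s \<Longrightarrow> evalsb P env es xs t \<Longrightarrow> evalsb P env (e # es) (x # xs) (s + t)"
  unfolding evalb_def evalsb_def using evalsto_Cons by (metis add_le_mono)

lemmas eval_rules = evalb_Var evalb_Nil evalb_Pair evalb_Fst evalb_Snd evalb_If
  branchb_Node branchb_Leaf branchb_bool evalb_App evalsb_Nil evalsb_Cons

subsection \<open>The enumeration program\<close>

text \<open>The first argument of \<open>App\<close> is the position of the called body in \<open>prog\<close>.\<close>

definition main_body :: expr where
  "main_body = IfE (FstE (Var 0))
     (App 4 [App 2 [FstE (SndE (Var 0)), App 1 [FstE (SndE (Var 0))]],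
             FstE (Var 0), FstE (SndE (SndE (SndE (SndE (Var 0)))))])
     NilE"

text \<open>The size bound for the subsets of \<open>L\<close>, in unary: the vertices outside
  \<open>L\<close> are counted starting from one instead of zero.\<close>

definition budget_body :: expr where
  "budget_body = IfE (Var 0)
     (IfE (FstE (Var 0)) (App 1 [SndE (Var 0)]) (PairE NilE (App 1 [SndE (Var 0)])))
     (PairE NilE NilE)"

text \<open>
  Bit vectors of the subsets of the first argument that have at most as many elements as the
  second argument, a unary number.
\<close>

definition subsets_body :: expr where
  "subsets_body = IfE (Var 0)
     (App 3 [NilE, App 2 [SndE (Var 0), Var 1],
        IfE (FstE (Var 0))
          (IfE (Var 1)
             (App 3 [PairE NilE NilE, App 2 [SndE (Var 0), SndE (Var 1)], NilE]) NilE)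
          NilE])
     (PairE NilE NilE)"

text \<open>Conses the first argument to all members of the second, in front of the third.\<close>

definition prefix_body :: expr where
  "prefix_body = IfE (Var 1)
     (PairE (PairE (Var 0) (FstE (Var 1))) (App 3 [Var 0, SndE (Var 1), Var 2]))
     (Var 2)"

definition filter_body :: expr where
  "filter_body = IfE (Var 0)
     (IfE (App 5 [Var 1, Var 2, FstE (Var 0)])
        (PairE (FstE (Var 0)) (App 4 [SndE (Var 0), Var 1, Var 2]))
        (App 4 [SndE (Var 0), Var 1, Var 2]))
     NilE"

definition minimal_body :: expr where
  "minimal_body = IfE (App 7 [Var 0, Var 1, Var 2])
     (App 6 [App 8 [Var 2], Var 0, Var 1]) NilE"

definition none_body :: expr where
  "none_body = IfE (Var 0)
     (IfE (App 7 [Var 1, Var 2, FstE (Var 0)]) NilE (App 6 [SndE (Var 0), Var 1, Var 2]))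
     (PairE NilE NilE)"

definition extension_body :: expr where
  "extension_body = App 10 [Var 0, App 9 [Var 1, Var 2]]"

definition deletions_body :: expr where
  "deletions_body = IfE (Var 0)
     (App 3 [FstE (Var 0), App 8 [SndE (Var 0)],
        IfE (FstE (Var 0)) (PairE (PairE NilE (SndE (Var 0))) NilE) NilE])
     NilE"

definition union_body :: expr where
  "union_body = IfE (Var 0)
     (PairE (IfE (FstE (Var 0)) (PairE NilE NilE) (FstE (Var 1)))
        (App 9 [SndE (Var 0), SndE (Var 1)]))
     NilE"

text \<open>
  The component of the first vertex of the given set is the fixed point reached after \<open>n\<close> rounds
  of adding adjacent vertices of that set; the rows of the adjacency matrix serve as the counter.
\<close>

definition cds_body :: expr where
  "cds_body = App 15 [Var 0, Var 1, App 13 [Var 0, Var 0, Var 1, App 11 [Var 1, NilE]], Var 1]"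

text \<open>The second argument tells whether a vertex has been kept already.\<close>

definition first_body :: expr where
  "first_body = IfE (Var 0)
     (IfE (Var 1) (PairE NilE (App 11 [SndE (Var 0), Var 1]))
        (PairE (FstE (Var 0)) (App 11 [SndE (Var 0), FstE (Var 0)])))
     NilE"

definition meets_body :: expr where
  "meets_body = IfE (Var 0)
     (IfE (FstE (Var 0))
        (IfE (FstE (Var 1)) (PairE NilE NilE) (App 12 [SndE (Var 0), SndE (Var 1)]))
        (App 12 [SndE (Var 0), SndE (Var 1)]))
     NilE"

definition iterate_body :: expr where
  "iterate_body = IfE (Var 0)
     (App 13 [SndE (Var 0), Var 1, Var 2, App 14 [Var 1, Var 2, Var 3, Var 3]])
     (Var 3)"

text \<open>One round of growth. The rows, the allowed set \<open>Var 1\<close> and the reached set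
  \<open>Var 2\<close> are consumed together, while \<open>Var 3\<close> keeps the whole reached set
  for the adjacency test.\<close>

definition step_body :: expr where
  "step_body = IfE (Var 0)
     (PairE
        (IfE (FstE (Var 2)) (PairE NilE NilE)
           (IfE (FstE (Var 1)) (App 12 [FstE (Var 0), Var 3]) NilE))
        (App 14 [SndE (Var 0), SndE (Var 1), SndE (Var 2), Var 3]))
     NilE"

text \<open>\<open>Var 1\<close> is the set to be tested, \<open>Var 2\<close> the component found
  in it, and \<open>Var 3\<close> the set once more, unconsumed. One pass tests connectedness and
  domination.\<close>

definition check_body :: expr where
  "check_body = IfE (Var 0)
     (IfE (FstE (Var 1))
        (IfE (FstE (Var 2))
           (App 15 [SndE (Var 0), SndE (Var 1), SndE (Var 2), Var 3]) NilE)
        (IfE (App 12 [FstE (Var 0), Var 3])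
           (App 15 [SndE (Var 0), SndE (Var 1), SndE (Var 2), Var 3]) NilE))
     (PairE NilE NilE)"

definition prog :: program where
  "prog = [main_body, budget_body, subsets_body, prefix_body, filter_body, minimal_body,
     none_body, extension_body, deletions_body, union_body, cds_body, first_body, meets_body,
     iterate_body, step_body, check_body]"

text \<open>Running a body symbolically leaves \<open>v = v'\<close> and \<open>s \<le> t\<close> as
  goals, where the computed value and time are compared with the stated ones.\<close>

lemma callb_prog:
  "evalb prog xs main_body v s \<Longrightarrow> v = v' \<Longrightarrow> s \<le> t \<Longrightarrow> callb prog 0 xs v' t"
  "evalb prog xs budget_body v s \<Longrightarrow> v = v' \<Longrightarrow> s \<le> t \<Longrightarrow> callb prog 1 xs v' t"
  "evalb prog xs subsets_body v s \<Longrightarrow> v = v' \<Longrightarrow> s \<le> t \<Longrightarrow> callb prog 2 xs v' t"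
  "evalb prog xs prefix_body v s \<Longrightarrow> v = v' \<Longrightarrow> s \<le> t \<Longrightarrow> callb prog 3 xs v' t"
  "evalb prog xs filter_body v s \<Longrightarrow> v = v' \<Longrightarrow> s \<le> t \<Longrightarrow> callb prog 4 xs v' t"
  "evalb prog xs minimal_body v s \<Longrightarrow> v = v' \<Longrightarrow> s \<le> t \<Longrightarrow> callb prog 5 xs v' t"
  "evalb prog xs none_body v s \<Longrightarrow> v = v' \<Longrightarrow> s \<le> t \<Longrightarrow> callb prog 6 xs v' t"
  "evalb prog xs extension_body v s \<Longrightarrow> v = v' \<Longrightarrow> s \<le> t \<Longrightarrow> callb prog 7 xs v' t"
  "evalb prog xs deletions_body v s \<Longrightarrow> v = v' \<Longrightarrow> s \<le> t \<Longrightarrow> callb prog 8 xs v' t"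
  "evalb prog xs union_body v s \<Longrightarrow> v = v' \<Longrightarrow> s \<le> t \<Longrightarrow> callb prog 9 xs v' t"
  "evalb prog xs cds_body v s \<Longrightarrow> v = v' \<Longrightarrow> s \<le> t \<Longrightarrow> callb prog 10 xs v' t"
  "evalb prog xs first_body v s \<Longrightarrow> v = v' \<Longrightarrow> s \<le> t \<Longrightarrow> callb prog 11 xs v' t"
  "evalb prog xs meets_body v s \<Longrightarrow> v = v' \<Longrightarrow> s \<le> t \<Longrightarrow> callb prog 12 xs v' t"
  "evalb prog xs iterate_body v s \<Longrightarrow> v = v' \<Longrightarrow> s \<le> t \<Longrightarrow> callb prog 13 xs v' t"
  "evalb prog xs step_body v s \<Longrightarrow> v = v' \<Longrightarrow> s \<le> t \<Longrightarrow> callb prog 14 xs v' t"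
  "evalb prog xs check_body v s \<Longrightarrow> v = v' \<Longrightarrow> s \<le> t \<Longrightarrow> callb prog 15 xs v' t"
  by (auto simp: callb_def evalb_def prog_def intro: order_trans)

subsection \<open>Values and running times of the functions\<close>

text \<open>Relative to a list, so that inductions can run along the vertices; for the list
  \<open>[0..<n]\<close> it is \<open>enc_set n X\<close>.\<close>

definition bits :: "'a set \<Rightarrow> 'a list \<Rightarrow> btree" where
  "bits X vs = enc_list (map (\<lambda>v. enc_bool (v \<in> X)) vs)"

lemma bits_simps:
  "bits X [] = Leaf" "bits X (v # vs) = Node (enc_bool (v \<in> X)) (bits X vs)"
  by (simp_all add: bits_def)

lemma bits_cong: "(\<And>v. v \<in> set vs \<Longrightarrow> v \<in> X \<longleftrightarrow> v \<in> Y) \<Longrightarrow> bits X vs = bits Y vs"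
  by (simp add: bits_def cong: map_cong)

definition rows :: "('a \<Rightarrow> 'a set) \<Rightarrow> 'a list \<Rightarrow> 'a list \<Rightarrow> btree" where
  "rows N ws vs = enc_list (map (\<lambda>v. bits (N v) ws) vs)"

lemma rows_simps:
  "rows N ws [] = Leaf" "rows N ws (v # vs) = Node (bits (N v) ws) (rows N ws vs)"
  by (simp_all add: rows_def)

definition unary :: "nat \<Rightarrow> btree" where
  "unary k = enc_list (replicate k Leaf)"

lemma unary_simps: "unary 0 = Leaf" "unary (Suc k) = Node Leaf (unary k)"
  by (simp_all add: unary_def)

lemma enc_bool_simps: "enc_bool True = Node Leaf Leaf" "enc_bool False = Leaf"
  by (simp_all add: enc_bool_def)


lemma callb_meets:
  "callb prog 12 [bits A vs, bits B vs] (enc_bool (A \<inter> B \<inter> set vs \<noteq> {})) (20 * (length vs + 1))"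
proof (induction vs)
  case Nil
  show ?case
    by (rule callb_prog, unfold meets_body_def bits_simps, (rule eval_rules)+)
      (auto simp: enc_bool_simps)
next
  case (Cons v vs)
  show ?case
    by (rule callb_prog, unfold meets_body_def bits_simps, (rule eval_rules Cons.IH)+)
      (auto simp: enc_bool_simps)
qed

lemma callb_union:
  "callb prog 9 [bits A vs, bits B vs] (bits (A \<union> B) vs) (20 * (length vs + 1))"
proof (induction vs)
  case Nil
  show ?case
    by (rule callb_prog, unfold union_body_def bits_simps, (rule eval_rules)+) auto
next
  case (Cons v vs)
  show ?case
    by (rule callb_prog, unfold union_body_def bits_simps, (rule eval_rules Cons.IH)+)
      (auto simp: enc_bool_simps)
qed

lemma callb_first:
  assumes "distinct vs"
  shows "callb prog 11 [bits X vs, enc_bool b]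
    (bits (if b then {} else set (take 1 (filter (\<lambda>v. v \<in> X) vs))) vs) (20 * (length vs + 1))"
  using assms
proof (induction vs arbitrary: b)
  case Nil
  show ?case
    by (rule callb_prog, unfold first_body_def bits_simps, (rule eval_rules)+) auto
next
  case (Cons v vs)
  then have IH: "callb prog 11 [bits X vs, enc_bool b]
    (bits (if b then {} else set (take 1 (filter (\<lambda>v. v \<in> X) vs))) vs) (20 * (length vs + 1))" for b
    by simp
  have "v \<notin> set (take 1 (filter (\<lambda>v. v \<in> X) vs))"
    using Cons.prems by (auto dest: in_set_takeD)
  moreover have "bits {v} vs = bits {} vs"
    using Cons.prems by (auto intro: bits_cong)
  ultimately show ?case
    by - (rule callb_prog, unfold first_body_def bits_simps, (rule eval_rules IH)+,
      auto simp: enc_bool_simps)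
qed

text \<open>One round of a search inside \<open>X\<close>; the intersection with
  \<open>set ws\<close> reflects that a matrix row shows only the columns \<open>ws\<close>.\<close>

definition grow :: "('a \<Rightarrow> 'a set) \<Rightarrow> 'a list \<Rightarrow> 'a set \<Rightarrow> 'a set \<Rightarrow> 'a set" where
  "grow N ws X Y = Y \<union> {v \<in> X. N v \<inter> Y \<inter> set ws \<noteq> {}}"

lemma callb_step:
  "callb prog 14 [rows N ws vs, bits X vs, bits Y vs, bits Y ws] (bits (grow N ws X Y) vs)
    (60 * (length ws + 1) * (length vs + 1))"
proof (induction vs)
  case Nil
  show ?case
    by (rule callb_prog, unfold step_body_def bits_simps rows_simps, (rule eval_rules)+) auto
next
  case (Cons v vs)
  show ?case
    by (rule callb_prog, unfold step_body_def bits_simps rows_simps,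
      (rule eval_rules Cons.IH callb_meets)+) (auto simp: enc_bool_simps grow_def)
qed

lemma callb_iterate:
  "callb prog 13 [enc_list us, rows N ws ws, bits X ws, bits Y ws]
    (bits ((grow N ws X ^^ length us) Y) ws) (80 * (length ws + 1)\<^sup>2 * (length us + 1))"
proof (induction us arbitrary: Y)
  case Nil
  show ?case
    by (rule callb_prog, unfold iterate_body_def enc_list.simps, (rule eval_rules)+)
      (auto simp: power2_eq_square)
next
  case (Cons u us)
  \<comment> \<open>Naming the square keeps the arithmetic linear. Below,
    \<open>funpow_swap1\<close> moves the step made before the recursive call to the other end of
    the iteration.\<close>
  define c where "c = (length ws + 1)\<^sup>2"
  have "1 \<le> c" by (simp add: c_def)
  moreover have "callb prog 14 [rows N ws ws, bits X ws, bits Y ws, bits Y ws]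
    (bits (grow N ws X Y) ws) (60 * c)" for Y
    using callb_step[of N ws ws X Y] by (simp add: c_def power2_eq_square algebra_simps)
  note step = this
  ultimately show ?case
    unfolding c_def[symmetric]
    by - (rule callb_prog, unfold iterate_body_def enc_list.simps,
      (rule eval_rules Cons.IH[folded c_def] step)+, simp_all add: funpow_swap1 algebra_simps)
qed

lemma callb_check:
  "callb prog 15 [rows N ws vs, bits X vs, bits Y vs, bits X ws]
    (enc_bool (\<forall>v\<in>set vs. if v \<in> X then v \<in> Y else N v \<inter> X \<inter> set ws \<noteq> {}))
    (40 * (length ws + 1) * (length vs + 1))"
proof (induction vs)
  case Nil
  show ?case
    by (rule callb_prog, unfold check_body_def bits_simps rows_simps, (rule eval_rules)+)
      (auto simp: enc_bool_simps)
next
  case (Cons v vs)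
  show ?case
    by (rule callb_prog, unfold check_body_def bits_simps rows_simps,
      (rule eval_rules Cons.IH callb_meets)+) (auto simp: enc_bool_simps)
qed

text \<open>\<open>Y\<close> is what the search from the first vertex of \<open>X\<close> has
  reached; the quantifier combines, for the vertices in \<open>ws\<close>,
  \<open>X \<subseteq> Y\<close> with domination.\<close>

definition cds_test :: "('a \<Rightarrow> 'a set) \<Rightarrow> 'a list \<Rightarrow> 'a set \<Rightarrow> bool" where
  "cds_test N ws X \<longleftrightarrow>
    (let Y = (grow N ws X ^^ length ws) (set (take 1 (filter (\<lambda>v. v \<in> X) ws)))
     in \<forall>v\<in>set ws. if v \<in> X then v \<in> Y else N v \<inter> X \<inter> set ws \<noteq> {})"

lemma callb_cds:
  assumes "distinct ws"
  shows "callb prog 10 [rows N ws ws, bits X ws] (enc_bool (cds_test N ws X))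
    (200 * (length ws + 1) ^ 3)"
proof -
  note first = callb_first[OF assms, of X False, unfolded enc_bool_simps if_False]
  note iter = callb_iterate[of "map (\<lambda>v. bits (N v) ws) ws" N ws, folded rows_def]
  have pow: "a ^ 2 \<le> a ^ 3 \<and> a \<le> a ^ 3 \<and> 1 \<le> a ^ 3" if "a \<ge> 1" for a :: nat
    using that power_increasing[of 2 3 a] power_increasing[of 1 3 a] by simp
  show ?thesis
    apply (rule callb_prog, unfold cds_body_def, (rule eval_rules first iter callb_check)+)
     apply (simp add: cds_test_def Let_def)
    using pow[of "length ws + 1"]
    by (simp add: power2_eq_square power3_eq_cube algebra_simps)
qed

lemma callb_extension:
  assumes "distinct ws"
  shows "callb prog 7 [rows N ws ws, bits A ws, bits S ws] (enc_bool (cds_test N ws (A \<union> S)))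
    (250 * (length ws + 1) ^ 3)"
proof -
  have pow: "a \<le> a ^ 3 \<and> 1 \<le> a ^ 3" if "a \<ge> 1" for a :: nat
    using that power_increasing[of 1 3 a] by simp
  show ?thesis
    apply (rule callb_prog, unfold extension_body_def,
        (rule eval_rules callb_union callb_cds[OF assms])+)
    using pow[of "length ws + 1"] by simp_all
qed

text \<open>The \<open>foldr\<close> form leaves the tail \<open>a\<close> an arbitrary tree, which
  callers fill with a conditional or with the value of another call.\<close>

lemma callb_prefix:
  "callb prog 3 [b, enc_list xs, a] (foldr (\<lambda>x. Node (Node b x)) xs a) (20 * (length xs + 1))"
proof (induction xs)
  case Nil
  show ?case
    by (rule callb_prog, unfold prefix_body_def enc_list.simps, (rule eval_rules)+) auto
next
  case (Cons x xs)
  show ?case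
    by (rule callb_prog, unfold prefix_body_def enc_list.simps, (rule eval_rules Cons.IH)+) auto
qed

lemma foldr_prefix:
  "foldr (\<lambda>x. Node (Node b x)) xs (enc_list as) = enc_list (map (Node b) xs @ as)"
  by (induction xs) auto

text \<open>Deletions from the tail get the head bit back by prefixing, and the deletion of the head
  is put behind them; hence \<open>rev\<close>.\<close>

lemma callb_deletions:
  assumes "distinct vs"
  shows "callb prog 8 [bits S vs]
    (enc_list (map (\<lambda>u. bits (S - {u}) vs) (rev (filter (\<lambda>v. v \<in> S) vs))))
    (40 * (length vs + 1)\<^sup>2)"
  using assms
proof (induction vs)
  case Nil
  show ?case
    by (rule callb_prog, unfold deletions_body_def bits_simps, (rule eval_rules)+) auto
next
  case (Cons v vs)
  have IH: "callb prog 8 [bits S vs]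
    (enc_list (map (\<lambda>u. bits (S - {u}) vs) (rev (filter (\<lambda>v. v \<in> S) vs))))
    (40 * (length vs + 1)\<^sup>2)" using Cons by simp
  let ?us = "rev (filter (\<lambda>v. v \<in> S) vs)"
  have dels: "map (Node (enc_bool (v \<in> S)) \<circ> (\<lambda>u. bits (S - {u}) vs)) ?us
    = map (\<lambda>u. bits (S - {u}) (v # vs)) ?us"
    using Cons.prems by (auto simp: bits_simps intro!: arg_cong[where f = enc_bool])
  have fold: "foldr (\<lambda>x. Node (Node (enc_bool (v \<in> S)) x)) (map (\<lambda>u. bits (S - {u}) vs) ?us) (enc_list as)
    = enc_list (map (\<lambda>u. bits (S - {u}) (v # vs)) ?us @ as)" for as
    by (simp only: foldr_prefix map_map dels)
  have "bits S vs = bits (S - {v}) vs" using Cons.prems by (auto intro: bits_cong)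
  then have "foldr (\<lambda>x. Node (Node (enc_bool (v \<in> S)) x)) (map (\<lambda>u. bits (S - {u}) vs) ?us)
      (if v \<in> S then Node (Node Leaf (bits S vs)) Leaf else Leaf)
    = enc_list (map (\<lambda>u. bits (S - {u}) (v # vs)) (rev (filter (\<lambda>v. v \<in> S) (v # vs))))"
    using fold[of "[]"] fold[of "[bits (S - {v}) (v # vs)]"]
    by (cases "v \<in> S") (simp_all add: bits_simps enc_bool_simps)
  note val = this[unfolded bits_simps]
  show ?case
    apply (rule callb_prog, unfold deletions_body_def bits_simps,
        (rule eval_rules IH callb_prefix)+)
     apply (rule val)
    apply (simp add: power2_eq_square)
    using length_filter_le[of "\<lambda>v. v \<in> S" vs] by linarith
qed

lemma callb_none:
  assumes "distinct ws"
  shows "callb prog 6 [enc_list (map (\<lambda>S. bits S ws) Ss), rows N ws ws, bits A ws]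
    (enc_bool (\<forall>S\<in>set Ss. \<not> cds_test N ws (A \<union> S))) (300 * (length ws + 1) ^ 3 * (length Ss + 1))"
proof (induction Ss)
  case Nil
  define c where "c = (length ws + 1) ^ 3"
  have "1 \<le> c" by (simp add: c_def)
  then show ?case
    unfolding c_def[symmetric]
    by - (rule callb_prog, unfold none_body_def enc_list.simps list.map, (rule eval_rules)+,
      auto simp: enc_bool_simps)
next
  case (Cons S Ss)
  define c where "c = (length ws + 1) ^ 3"
  have "1 \<le> c" by (simp add: c_def)
  then show ?case
    unfolding c_def[symmetric]
    by - (rule callb_prog, unfold none_body_def enc_list.simps list.map,
      (rule eval_rules Cons.IH[folded c_def] callb_extension[OF assms, folded c_def])+, auto simp: enc_bool_simps)
qed

definition minimal_test :: "('a \<Rightarrow> 'a set) \<Rightarrow> 'a list \<Rightarrow> 'a set \<Rightarrow> 'a set \<Rightarrow> bool" where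
  "minimal_test N ws A S \<longleftrightarrow> cds_test N ws (A \<union> S) \<and>
    (\<forall>v\<in>S \<inter> set ws. \<not> cds_test N ws (A \<union> (S - {v})))"

lemma callb_minimal:
  assumes "distinct ws"
  shows "callb prog 5 [rows N ws ws, bits A ws, bits S ws] (enc_bool (minimal_test N ws A S))
    (700 * (length ws + 1) ^ 4)"
proof -
  let ?us = "rev (filter (\<lambda>v. v \<in> S) ws)"
  note none = callb_none[OF assms, of "map (\<lambda>u. S - {u}) ?us", unfolded map_map comp_def]
  have pow: "a ^ 2 \<le> a ^ 4 \<and> a ^ 3 \<le> a ^ 4 \<and> 1 \<le> a ^ 4" if "a \<ge> 1" for a :: nat
    using that power_increasing[of 2 4 a] power_increasing[of 3 4 a] by simp
  have "300 * (length ws + 1) ^ 3 * (length ?us + 1) \<le> 300 * (length ws + 1) ^ 3 * (length ws + 1)"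
    by (intro mult_le_mono2 add_le_mono1) simp
  also have "\<dots> = 300 * (length ws + 1) ^ 4"
    using power_add[of "length ws + 1" 3 1] by (simp only: mult.assoc) simp
  finally have time: "300 * (length ws + 1) ^ 3 * (length ?us + 1) \<le> 300 * (length ws + 1) ^ 4" .
  have arith: "1 + (1 + (1 + 0)) + 250 * c3 + 1 +
      max (1 + 0 + 40 * c2 + 1 + (1 + (1 + 0)) + x + 1) 1 + 1 \<le> 700 * c4"
    if "c2 \<le> c4" "c3 \<le> c4" "1 \<le> c4" "x \<le> 300 * c4" for c2 c3 c4 x :: nat
    using that by linarith
  have "(\<forall>S'\<in>set (map (\<lambda>u. S - {u}) ?us). \<not> cds_test N ws (A \<union> S')) \<longleftrightarrow>
    (\<forall>v\<in>S \<inter> set ws. \<not> cds_test N ws (A \<union> (S - {v})))"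
    unfolding set_map set_rev set_filter by blast
  note val = this
  show ?thesis
    apply (rule callb_prog, unfold minimal_body_def,
        (rule eval_rules callb_extension[OF assms] callb_deletions[OF assms] none)+)
     apply (simp only: val minimal_test_def enc_bool_def split: if_split)
     apply blast
    by (rule arith) (use pow[of "length ws + 1"] time in simp_all)
qed

lemma callb_filter:
  assumes "distinct ws"
  shows "callb prog 4 [enc_list (map (\<lambda>S. bits S ws) Ss), rows N ws ws, bits A ws]
    (enc_list (map (\<lambda>S. bits S ws) (filter (minimal_test N ws A) Ss)))
    (800 * (length ws + 1) ^ 4 * (length Ss + 1))"
proof (induction Ss)
  case Nil
  define c where "c = (length ws + 1) ^ 4"
  have "1 \<le> c" by (simp add: c_def)
  then show ?case
    unfolding c_def[symmetric]
    by - (rule callb_prog, unfold filter_body_def enc_list.simps list.map, (rule eval_rules)+, auto)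
next
  case (Cons S Ss)
  define c where "c = (length ws + 1) ^ 4"
  have "1 \<le> c" by (simp add: c_def)
  then show ?case
    unfolding c_def[symmetric]
    by - (rule callb_prog, unfold filter_body_def enc_list.simps list.map,
      (rule eval_rules Cons.IH[folded c_def] callb_minimal[OF assms, folded c_def])+, auto)
qed

section \<open>Enumeration of the subsets of bounded size\<close>

lemma callb_budget:
  "callb prog 1 [bits L vs] (unary (Suc (length (filter (\<lambda>v. v \<notin> L) vs)))) (20 * (length vs + 1))"
proof (induction vs)
  case Nil
  show ?case
    by (rule callb_prog, unfold budget_body_def bits_simps, (rule eval_rules)+)
      (auto simp: unary_simps)
next
  case (Cons v vs)
  show ?case
    by (rule callb_prog, unfold budget_body_def bits_simps, (rule eval_rules Cons.IH)+)
      (auto simp: unary_simps)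
qed

fun bounded_subsets :: "'a set \<Rightarrow> 'a list \<Rightarrow> nat \<Rightarrow> 'a set list" where
  "bounded_subsets L [] k = [{}]"
| "bounded_subsets L (v # vs) k = bounded_subsets L vs k @
     (if v \<in> L \<and> k > 0 then map (insert v) (bounded_subsets L vs (k - 1)) else [])"

lemma length_bounded_subsets_pos: "1 \<le> length (bounded_subsets L vs k)"
  by (induction vs arbitrary: k) (auto intro: trans_le_add1)

lemma set_bounded_subsets:
  assumes "distinct vs"
  shows "set (bounded_subsets L vs k) = {S. S \<subseteq> L \<inter> set vs \<and> card S \<le> k}"
  using assms
proof (induction vs arbitrary: k)
  case Nil
  then show ?case by auto
next
  case (Cons v vs)
  have ins: "card (insert v S) = Suc (card S)" if "S \<subseteq> L \<inter> set vs" for S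
    using that Cons.prems finite_subset[of S "set vs"] by (subst card_insert_disjoint) auto
  show ?case
  proof (intro set_eqI iffI)
    fix S assume "S \<in> set (bounded_subsets L (v # vs) k)"
    then show "S \<in> {S. S \<subseteq> L \<inter> set (v # vs) \<and> card S \<le> k}"
      using Cons ins by (auto split: if_splits)
  next
    fix S assume S: "S \<in> {S. S \<subseteq> L \<inter> set (v # vs) \<and> card S \<le> k}"
    show "S \<in> set (bounded_subsets L (v # vs) k)"
    proof (cases "v \<in> S")
      case False
      then show ?thesis using S Cons by auto
    next
      case True
      define S' where "S' = S - {v}"
      have S': "S = insert v S'" "S' \<subseteq> L \<inter> set vs" using True S by (auto simp: S'_def)
      have k: "Suc (card S') \<le> k" using S S' ins[OF S'(2)] by simp
      then have "S' \<in> set (bounded_subsets L vs (k - 1))" using S' Cons by simp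
      moreover have "v \<in> L" "k > 0" using True S k by auto
      ultimately show ?thesis using S'(1) by simp
    qed
  qed
qed

lemma distinct_bounded_subsets: "distinct vs \<Longrightarrow> distinct (bounded_subsets L vs k)"
proof (induction vs arbitrary: k)
  case (Cons v vs)
  have "inj_on (insert v) {S. v \<notin> S}" by (auto simp: inj_on_def)
  then have "inj_on (insert v) (set (bounded_subsets L vs (k - 1)))"
    by (rule inj_on_subset) (use Cons.prems in \<open>auto simp: set_bounded_subsets\<close>)
  then show ?case
    using Cons by (auto simp: distinct_map set_bounded_subsets)
qed simp

text \<open>For \<open>v \<in> L\<close> and \<open>k > 0\<close> the bounds for \<open>k\<close>
  and \<open>k - 1\<close> add up, and \<open>2 ^ k + 2 ^ (k - 1) = (3 / 2) * 2 ^ k\<close>. Thus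
  each vertex of \<open>L\<close> costs a factor 3/2.\<close>

lemma length_bounded_subsets_le:
  "real (length (bounded_subsets L vs k)) \<le> 2 ^ k * (3 / 2) ^ length (filter (\<lambda>v. v \<in> L) vs)"
proof (induction vs arbitrary: k)
  case (Cons v vs)
  show ?case
  proof (cases "v \<in> L")
    case False
    then show ?thesis using Cons.IH[of k] by simp
  next
    case True
    show ?thesis
    proof (cases k)
      case 0
      then show ?thesis using Cons.IH[of 0] by simp
    next
      case (Suc j)
      then show ?thesis using Cons.IH[of k] Cons.IH[of j] True by simp
    qed
  qed
qed simp

text \<open>Every call returns at least one set, so its overhead can be charged to its output; each
  level adds a constant cost per set for prefixing a bit.\<close>

lemma callb_subsets:
  assumes "distinct vs"
  shows "callb prog 2 [bits L vs, unary k]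
    (enc_list (map (\<lambda>S. bits S vs) (bounded_subsets L vs k)))
    (100 * (length vs + 1) * length (bounded_subsets L vs k))"
  using assms
proof (induction vs arbitrary: k)
  case Nil
  show ?case
    by (rule callb_prog, unfold subsets_body_def bits_simps, (rule eval_rules)+)
      (auto simp: bits_simps)
next
  case (Cons v vs)
  have IH: "callb prog 2 [bits L vs, unary k]
    (enc_list (map (\<lambda>S. bits S vs) (bounded_subsets L vs k)))
    (100 * (length vs + 1) * length (bounded_subsets L vs k))" for k
    using Cons by simp
  have sub: "S \<subseteq> set vs" if "S \<in> set (bounded_subsets L vs k)" for S k
    using that Cons.prems by (auto simp: set_bounded_subsets)
  have without: "map (Node Leaf \<circ> (\<lambda>S. bits S vs)) (bounded_subsets L vs k)
    = map (\<lambda>S. bits S (v # vs)) (bounded_subsets L vs k)" for k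
    using Cons.prems sub by (auto simp: bits_simps enc_bool_def)
  have incl: "map (Node (Node Leaf Leaf) \<circ> (\<lambda>S. bits S vs)) (bounded_subsets L vs k)
    = map ((\<lambda>S. bits S (v # vs)) \<circ> insert v) (bounded_subsets L vs k)" for k
    using Cons.prems sub by (auto simp: bits_simps enc_bool_def intro!: bits_cong)
  have nil: "foldr (\<lambda>x. Node (Node b x)) xs Leaf = enc_list (map (Node b) xs)" for b xs
    using foldr_prefix[of b xs "[]"] by simp
  have pos: "1 \<le> length (bounded_subsets L vs k)" for k
    by (rule length_bounded_subsets_pos)
  show ?case
  proof (cases "v \<in> L \<and> k > 0")
    case True
    then obtain j where k: "k = Suc j" by (cases k) auto
    have b: "enc_bool (v \<in> L) = Node Leaf Leaf" using True by (simp add: enc_bool_def)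
    show ?thesis
      unfolding k
      apply (rule callb_prog, unfold subsets_body_def bits_simps unary_simps b,
          (rule eval_rules IH[of j] IH[of "Suc j", unfolded unary_simps] callb_prefix)+)
      using pos[of j] pos[of "Suc j"] True
      by (auto simp: nil foldr_prefix without incl bits_simps algebra_simps)
  next
    case False
    show ?thesis
    proof (cases k)
      \<comment> \<open>Here \<open>v\<close> may lie in \<open>L\<close>, but the budget is
        exhausted, so either value of its bit gives no further sets.\<close>
      case 0
      show ?thesis
        unfolding 0
        apply (rule callb_prog, unfold subsets_body_def bits_simps unary_simps,
            (rule eval_rules IH[of 0, unfolded unary_simps] callb_prefix)+)
        using pos[of 0] by (auto simp: nil without bits_simps algebra_simps)
    next
      case (Suc j)
      then have b: "enc_bool (v \<in> L) = Leaf" using False by (simp add: enc_bool_def)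
      show ?thesis
        apply (rule callb_prog, unfold subsets_body_def bits_simps b,
            (rule eval_rules IH callb_prefix)+)
        using pos[of k] False by (auto simp: nil without bits_simps algebra_simps)
    qed
  qed
qed

lemma callb_main:
  fixes L :: "'a set"
  assumes "ws \<noteq> []" "distinct ws"
  defines "Ss \<equiv> bounded_subsets L ws (Suc (length (filter (\<lambda>v. v \<notin> L) ws)))"
  shows "callb prog 0 [enc_list [rows N ws ws, bits L ws, h, r, bits A ws, out]]
    (enc_list (map (\<lambda>S. bits S ws) (filter (minimal_test N ws A) Ss)))
    (3000 * (length ws + 1) ^ 4 * length Ss)"
proof -
  have branch: "branchb P env (rows N ws ws) e1 e2 v t" if "evalb P env e1 v t" for P env e1 e2 v t
    using that assms(1) by (cases ws) (simp_all add: rows_simps branchb_Node)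
  have pos: "1 \<le> length Ss" unfolding Ss_def by (rule length_bounded_subsets_pos)
  have pow: "length ws + 1 \<le> (length ws + 1) ^ 4" "1 \<le> (length ws + 1) ^ 4"
    using power_increasing[of 1 4 "length ws + 1"] by simp_all
  define a where "a = (length ws + 1) ^ 4"
  have "(length ws + 1) * length Ss \<le> a * length Ss"
    using pow by (intro mult_le_mono1) (simp add: a_def)
  then have as: "length ws * length Ss + length Ss \<le> a * length Ss" by simp
  have "a \<le> a * length Ss" using pos by simp
  note as = as this
  show ?thesis
    apply (rule callb_prog, unfold main_body_def enc_list.simps,
        (rule eval_rules branch callb_budget callb_subsets[OF assms(2)] callb_filter[OF assms(2)])+)
     apply (simp add: Ss_def)
    using pow pos as unfolding Ss_def[symmetric] a_def[symmetric]
    by (simp only: distrib_left distrib_right mult.assoc)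
qed

text \<open>The matrix of the empty graph is a leaf, which the guard of \<open>main_body\<close>
  answers with the empty list.\<close>

lemma callb_main_Nil: "callb prog 0 [enc_list (Leaf # xs)] Leaf 5"
  by (rule callb_prog, unfold main_body_def enc_list.simps, (rule eval_rules)+) auto

subsection \<open>Correctness of the connectivity test\<close>

text \<open>Until it is stable, every round adds an element; starting from a nonempty set, round
  \<open>i\<close> then has more than \<open>i\<close> elements, which is impossible for
  \<open>i = length ws\<close>.\<close>

lemma inflationary_iterate_stable:
  assumes "\<And>Z. Z \<subseteq> f Z" "\<And>i. (f ^^ i) Y \<subseteq> set ws" "Y \<noteq> {}"
  shows "f ((f ^^ length ws) Y) = (f ^^ length ws) Y"
proof -
  have fin: "finite ((f ^^ i) Y)" for i using assms(2) finite_subset by blast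
  have "f ((f ^^ i) Y) = (f ^^ i) Y \<or> i < card ((f ^^ i) Y)" for i
  proof (induction i)
    case 0
    then show ?case using assms(3) fin[of 0] by (auto simp: card_gt_0_iff)
  next
    case (Suc i)
    show ?case
    proof (cases "f ((f ^^ i) Y) = (f ^^ i) Y")
      case True
      then show ?thesis by simp
    next
      case False
      then have "card ((f ^^ i) Y) < card ((f ^^ Suc i) Y)"
        using assms(1) by (intro psubset_card_mono fin) auto
      then show ?thesis using Suc False by simp
    qed
  qed
  moreover have "card ((f ^^ length ws) Y) \<le> length ws"
    using card_mono[OF _ assms(2)] card_length le_trans by blast
  ultimately show ?thesis by (meson not_le)
qed

text \<open>The reached set \<open>Y\<close> is a connected subset of \<open>X\<close> and stable
  under \<open>grow\<close>. If \<open>X\<close> is connected and \<open>Y\<close> is proper, an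
  edge from \<open>Y\<close> to \<open>X - Y\<close> contradicts stability.\<close>

lemma cds_test_iff:
  assumes G: "pair_graph G" and ws: "set ws = pverts G" "ws \<noteq> []" and X: "X \<subseteq> pverts G"
  shows "cds_test (neighbors G) ws X \<longleftrightarrow> connected_dominating_set G X"
proof (cases "X = {}")
  \<comment> \<open>The empty set fails on both sides: it is not connected, and as \<open>ws\<close>
    is nonempty some vertex is not dominated.\<close>
  case True
  then show ?thesis
    using ws by (cases ws)
      (auto simp: cds_test_def connected_dominating_set_linked[OF G] linked_def)
next
  case False
  note sym = pair_graph_sym[OF G]
  define f where "f = grow (neighbors G) ws X"
  have f: "f Z = Z \<union> {v \<in> X. neighbors G v \<inter> Z \<inter> set ws \<noteq> {}}" for Z
    by (simp add: f_def grow_def)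
  have "filter (\<lambda>v. v \<in> X) ws \<noteq> []" using False X ws by (auto simp: filter_empty_conv)
  then obtain x xs where x: "filter (\<lambda>v. v \<in> X) ws = x # xs" by (cases "filter (\<lambda>v. v \<in> X) ws") auto
  then have "x \<in> set (filter (\<lambda>v. v \<in> X) ws)" by simp
  then have xX: "x \<in> X" by simp
  have f_linked: "linked (parcs G) (f Z)" if "linked (parcs G) Z" for Z
    by (rule linked_superset[OF sym that]) (auto simp: f neighbors_def)
  have f_sub: "f Z \<subseteq> X" if "Z \<subseteq> X" for Z
    using that by (auto simp: f)
  have inv: "(f ^^ i) {x} \<subseteq> X \<and> linked (parcs G) ((f ^^ i) {x})" for i
  proof (induction i)
    case 0
    then show ?case using xX by (simp add: linked_singleton)
  next
    case (Suc i)
    then show ?case using f_linked[of "(f ^^ i) {x}"] f_sub[of "(f ^^ i) {x}"] by simp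
  qed
  define Y where "Y = (f ^^ length ws) {x}"
  have stable: "f Y = Y"
    unfolding Y_def
  proof (rule inflationary_iterate_stable)
    show "(f ^^ i) {x} \<subseteq> set ws" for i using inv[of i] X ws by auto
  qed (auto simp: f)
  have Y: "Y \<subseteq> X" "linked (parcs G) Y" using inv by (auto simp: Y_def)
  have "X \<subseteq> Y \<longleftrightarrow> linked (parcs G) X"
  proof
    assume "X \<subseteq> Y"
    then show "linked (parcs G) X" using Y by (metis subset_antisym)
  next
    assume lX: "linked (parcs G) X"
    show "X \<subseteq> Y"
    proof (rule ccontr)
      assume "\<not> X \<subseteq> Y"
      then have "Y \<noteq> X" "Y \<noteq> {}" using Y by (auto simp: linked_def)
      then obtain u v where uv: "u \<in> Y" "v \<in> X - Y" "(u, v) \<in> parcs G"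
        using linked_crossing_edge[OF lX Y(1)] by metis
      have "u \<in> set ws" using uv Y X ws by auto
      then have "v \<in> f Y" using uv sym by (auto simp: f neighbors_def dest: symD)
      then show False using stable uv by simp
    qed
  qed
  moreover have "cds_test (neighbors G) ws X \<longleftrightarrow>
    X \<subseteq> Y \<and> (\<forall>v \<in> pverts G - X. neighbors G v \<inter> X \<noteq> {})"
  proof -
    have "neighbors G v \<inter> X \<inter> set ws = neighbors G v \<inter> X" for v using X ws by auto
    then show ?thesis using X ws(1) by (auto simp: cds_test_def x Let_def simp flip: f_def Y_def)
  qed
  ultimately show ?thesis
    using X by (auto simp: connected_dominating_set_linked[OF G])
qed

section \<open>Numerical bounds on the number of small subsets\<close>

text \<open>The enumeration doubles as a counting device: its length bound, for a list of the
  elements of \<open>L\<close>, bounds the cardinality.\<close>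

lemma card_small_subsets_le:
  assumes "finite L"
  shows "finite {S. S \<subseteq> L \<and> card S \<le> k}"
    "real (card {S. S \<subseteq> L \<and> card S \<le> k}) \<le> 2 ^ k * (3 / 2) ^ card L"
proof -
  obtain vs where vs: "set vs = L" "distinct vs" using finite_distinct_list[OF assms] by blast
  have eq: "{S. S \<subseteq> L \<and> card S \<le> k} = set (bounded_subsets L vs k)"
    using vs by (simp add: set_bounded_subsets)
  then show "finite {S. S \<subseteq> L \<and> card S \<le> k}" by simp
  have "filter (\<lambda>v. v \<in> L) vs = vs" using vs by simp
  then show "real (card {S. S \<subseteq> L \<and> card S \<le> k}) \<le> 2 ^ k * (3 / 2) ^ card L"
    using length_bounded_subsets_le[of L vs k] distinct_card[OF vs(2)] vs(1) card_length eq
    by (metis of_nat_mono order_trans)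
qed

text \<open>The point is \<open>(3 / 2) ^ 10 \<le> 2 ^ 6\<close>.\<close>

lemma two_power_bound:
  assumes "10 * k \<le> 3 * m"
  shows "2 ^ k * (3 / 2) ^ m \<le> 2 powr real m * 2 powr (- (real m / 10))"
proof -
  have "(2 powr (6 / 10) :: real) ^ 10 = 2 powr 6" by (simp add: powr_power)
  then have "(3 / 2 :: real) ^ 10 \<le> (2 powr (6 / 10)) ^ 10" by (simp add: power_divide)
  then have "(3 / 2 :: real) \<le> 2 powr (6 / 10)"
    by (rule power_le_imp_le_base[where n = 9, simplified]) simp
  then have "(3 / 2 :: real) ^ m \<le> (2 powr (6 / 10)) ^ m"
    by (rule power_mono) simp
  also have "\<dots> = 2 powr (6 / 10 * real m)"
    by (simp add: powr_power mult.commute)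
  finally have m: "(3 / 2 :: real) ^ m \<le> 2 powr (6 / 10 * real m)" .
  have "(2 :: real) ^ k = 2 powr real k" by (simp add: powr_realpow)
  also have "\<dots> \<le> 2 powr (3 / 10 * real m)"
    using assms by (intro powr_mono) linarith+
  finally have "2 ^ k * (3 / 2) ^ m \<le> 2 powr (3 / 10 * real m) * 2 powr (6 / 10 * real m)"
    using m by (intro mult_mono) auto
  \<comment> \<open>The exponents give 3/10 + 6/10 = 1 - 1/10.\<close>
  also have "\<dots> = 2 powr real m * 2 powr (- (real m / 10))"
    by (simp flip: powr_add)
  finally show ?thesis .
qed

subsection \<open>Counting and enumerating the minimal extensions\<close>

lemma excellent_minimal_extension:
  assumes G: "pair_graph G" and part: "excellent_partition l G L H R"
    and IO: "In \<union> Out = H \<union> R" "In \<inter> Out = {}" and S: "minimal_extension G In Out S"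
  shows "S \<subseteq> L" "card S \<le> max 1 (card (H \<union> R))"
proof -
  note part' = excellent_partitionD[OF part]
  have V: "pverts G = L \<union> In \<union> Out" using part'(1) IO(1) by auto
  show "S \<subseteq> L" "card S \<le> max 1 (card (H \<union> R))"
    using minimal_extension_card_le[OF G V part'(2)[folded IO(1)] part'(3)
        part'(4)[folded IO(1)] IO(2) S]
    unfolding IO(1) by blast+
qed

lemma card_minimal_extensions_le:
  assumes l: "l \<ge> 1" and G: "pair_graph G" and part: "excellent_partition l G L H R"
    and IO: "In \<union> Out = H \<union> R" "In \<inter> Out = {}"
    and low: "real (card {v \<in> R. degree G v < 10 * l}) \<le> real (card L) / 10"
  shows "real (card {S. minimal_extension G In Out S})
    \<le> 2 powr real (card L) * 2 powr (- (real (card L) / 10))"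
proof -
  note part' = excellent_partitionD[OF part]
  have fin: "finite L" "finite (H \<union> R)"
    using pair_graph_finite[OF G] part'(1) by (metis finite_Un)+
  note min = excellent_minimal_extension[OF G part IO]
  show ?thesis
  proof (cases "H \<union> R = {}")
    \<comment> \<open>Here the size bound is 1 and not \<open>card (H \<union> R)\<close>. But
      \<open>S\<close> alone must dominate the independent set \<open>L\<close>, so \<open>L\<close>
      is the only candidate.\<close>
    case True
    have "S = L" if "minimal_extension G In Out S" for S
    proof -
      have "In = {}" using IO True by auto
      then have "\<forall>v\<in>L - S. neighbors G v \<inter> S \<noteq> {}"
        using that True part'(1)
        by (auto simp: minimal_extension_def extension_def connected_dominating_set_def)
      then show ?thesis using min(1)[OF that] part'(3) by (fastforce simp: neighbors_def)
    qed
    then have "{S. minimal_extension G In Out S} \<subseteq> {L}" by auto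
    then have "real (card {S. minimal_extension G In Out S}) \<le> 1"
      using card_mono[of "{L}"] by fastforce
    also have "\<dots> \<le> 2 powr real (card L) * 2 powr (- (real (card L) / 10))"
      by (simp add: ge_one_powr_ge_zero flip: powr_add)
    finally show ?thesis .
  next
    case False
    have "max 1 (card (H \<union> R)) = card (H \<union> R)"
      using False fin by (simp add: Suc_le_eq card_gt_0_iff max_def)
    then have "{S. minimal_extension G In Out S} \<subseteq> {S. S \<subseteq> L \<and> card S \<le> card (H \<union> R)}"
      using min by auto
    then have "real (card {S. minimal_extension G In Out S})
      \<le> real (card {S. S \<subseteq> L \<and> card S \<le> card (H \<union> R)})"
      by (intro of_nat_mono card_mono card_small_subsets_le(1) fin(1))
    also have "\<dots> \<le> 2 ^ card (H \<union> R) * (3 / 2) ^ card L"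
      by (rule card_small_subsets_le(2)[OF fin(1)])
    also have "\<dots> \<le> 2 powr real (card L) * 2 powr (- (real (card L) / 10))"
      by (rule two_power_bound[OF excellent_partition_card[OF G l part low]])
    finally show ?thesis .
  qed
qed

text \<open>The two extra steps are the evaluation of the argument \<open>Var 0\<close> and the call
  itself.\<close>

lemma computes_in_time_callb:
  assumes "callb P 0 [x] y T"
  obtains t where "t \<le> T + 2" "computes_in_time P x y t"
proof -
  have "evalb P [x] (App 0 [Var 0]) y (1 + 0 + T + 1)"
    by (rule eval_rules assms)+
  then show thesis using that by (auto simp: evalb_def computes_in_time_def)
qed

lemma prog_enumerates:
  assumes l: "l \<ge> 1" and G: "pair_graph G" and V: "pverts G = {0..<n}"
    and part: "excellent_partition l G L H R"
    and IO: "In \<union> Out = H \<union> R" "In \<inter> Out = {}"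
    and low: "real (card {v \<in> R. degree G v < 10 * l}) \<le> real (card L) / 10"
  shows "\<exists>t. enumerates_in_time prog n (enc_instance n G L H R In Out)
      {S. minimal_extension G In Out S} t \<and>
    real t \<le> 2 powr real (card L) * 2 powr (- (real (card L) / 10)) * real (max 2 n) ^ 21"
proof -
  note part' = excellent_partitionD[OF part]
  define B where "B = 2 powr real (card L) * 2 powr (- (real (card L) / 10))"
  define M where "M = real (max 2 n)"
  have B: "1 \<le> B" by (simp add: B_def ge_one_powr_ge_zero flip: powr_add)
  have M: "2 \<le> M" by (simp add: M_def)
  show ?thesis
  proof (cases "n = 0")
    case True
    have "\<not> minimal_extension G In Out S" for S
      using V True by (auto simp: minimal_extension_def extension_def linked_def
          connected_dominating_set_linked[OF G])
    moreover have "enc_instance n G L H R In Out = enc_list (Leaf # map (enc_set n) [L, H, R, In, Out])"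
      by (simp add: enc_instance_def enc_graph_def True)
    then obtain t where t: "t \<le> 5 + 2"
      "computes_in_time prog (enc_instance n G L H R In Out) Leaf t"
      using computes_in_time_callb[OF callb_main_Nil] by metis
    ultimately have "enumerates_in_time prog n (enc_instance n G L H R In Out)
      {S. minimal_extension G In Out S} t"
      unfolding enumerates_in_time_def by (intro exI[of _ "[]"]) simp
    moreover have "real t \<le> B * M ^ 21"
    proof -
      have "real t \<le> 1 * 2 ^ 21" using t by simp
      also have "\<dots> \<le> B * M ^ 21" using B M by (intro mult_mono power_mono) auto
      finally show ?thesis .
    qed
    ultimately show ?thesis unfolding B_def M_def by blast
  next
    case False
    define ws where "ws = [0..<n]"
    have ws: "ws \<noteq> []" "distinct ws" "set ws = pverts G" "length ws = n"
      using False V by (auto simp: ws_def)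
    \<comment> \<open>The program allows \<open>k + 1\<close> elements because \<open>k\<close> may be \<open>0\<close> while \<open>L\<close> is a single vertex.\<close>
    define k where "k = length (filter (\<lambda>v. v \<notin> L) ws)"
    have "{v. v \<notin> L} \<inter> set ws = H \<union> R" using part' ws by auto
    then have k: "k = card (H \<union> R)"
      unfolding k_def distinct_length_filter[OF ws(2)] by simp
    have m: "length (filter (\<lambda>v. v \<in> L) ws) = card L"
      unfolding distinct_length_filter[OF ws(2)] using part' ws by (auto intro!: arg_cong[where f = card])
    define Ss where "Ss = filter (minimal_test (neighbors G) ws In) (bounded_subsets L ws (Suc k))"
    \<comment> \<open>A subset of \<open>L\<close> is automatically disjoint from
      \<open>In \<union> Out\<close>, so being an extension reduces to connected domination.\<close>
    have test: "minimal_test (neighbors G) ws In S \<longleftrightarrow> minimal_extension G In Out S" if "S \<subseteq> L" for S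
    proof -
      have ext: "cds_test (neighbors G) ws (In \<union> T) \<longleftrightarrow> extension G In Out T" if "T \<subseteq> L" for T
      proof -
        have "In \<union> T \<subseteq> pverts G" "T \<inter> (In \<union> Out) = {}" "T \<subseteq> pverts G"
          using that part' IO by auto
        then show ?thesis using cds_test_iff[OF G ws(3,1)] by (simp add: extension_def)
      qed
      have "S \<inter> set ws = S" using that part' ws by auto
      moreover have "S - {v} \<subseteq> L" for v using that by auto
      ultimately show ?thesis
        using that by (simp add: minimal_test_def minimal_extension_iff[OF G] ext)
    qed
    have setSs: "set Ss = {S. minimal_extension G In Out S}"
    proof -
      have small: "S \<subseteq> L" "card S \<le> Suc k" if "minimal_extension G In Out S" for S
        using excellent_minimal_extension[OF G part IO that] k by auto
      have "set ws \<inter> L = L" using part' ws by auto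
      then show ?thesis
        using test small by (auto simp: Ss_def set_bounded_subsets[OF ws(2)])
    qed
    have inst: "enc_instance n G L H R In Out =
      enc_list [rows (neighbors G) ws ws, bits L ws, enc_set n H, enc_set n R, bits In ws, enc_set n Out]"
      by (simp add: enc_instance_def enc_graph_def rows_def bits_def enc_set_def ws_def)
    note run = callb_main[OF ws(1,2), where L = L and N = "neighbors G" and A = In
        and h = "enc_set n H" and r = "enc_set n R" and out = "enc_set n Out",
        folded k_def, folded Ss_def, unfolded ws(4), folded inst]
    obtain t where t: "t \<le> 3000 * (n + 1) ^ 4 * length (bounded_subsets L ws (Suc k)) + 2"
      "computes_in_time prog (enc_instance n G L H R In Out) (enc_list (map (\<lambda>S. bits S ws) Ss)) t"
      by (rule computes_in_time_callb[OF run])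
    have "distinct Ss"
      by (simp add: Ss_def distinct_bounded_subsets[OF ws(2)])
    moreover have "(\<lambda>S. bits S ws) = enc_set n"
      by (auto simp: bits_def enc_set_def ws_def)
    ultimately have "enumerates_in_time prog n (enc_instance n G L H R In Out)
      {S. minimal_extension G In Out S} t"
      unfolding enumerates_in_time_def using setSs t by auto
    moreover have "real t \<le> B * M ^ 21"
    proof -
      \<comment> \<open>The extra unit of budget costs a factor 2.\<close>
      have "real (length (bounded_subsets L ws (Suc k))) \<le> 2 * (2 ^ k * (3 / 2) ^ card L)"
        using length_bounded_subsets_le[of L ws "Suc k"] m by simp
      also have "\<dots> \<le> 2 * B"
        using two_power_bound[OF excellent_partition_card[OF G l part low]] by (simp add: k B_def)
      finally have len: "real (length (bounded_subsets L ws (Suc k))) \<le> 2 * B" .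
      have "real (n + 1) \<le> 2 * M" by (simp add: M_def)
      also have "\<dots> \<le> M ^ 2" using M by (simp add: power2_eq_square)
      finally have "real (n + 1) ^ 4 \<le> (M ^ 2) ^ 4" by (intro power_mono) auto
      then have pow: "real (n + 1) ^ 4 \<le> M ^ 8" by simp
      have "real t \<le> real (3000 * (n + 1) ^ 4 * length (bounded_subsets L ws (Suc k)) + 2)"
        using t(1) by (rule of_nat_mono)
      also have "\<dots> = 3000 * real (n + 1) ^ 4 * real (length (bounded_subsets L ws (Suc k))) + 2"
        by (simp only: of_nat_add of_nat_mult of_nat_power of_nat_numeral)
      also have "\<dots> \<le> 3000 * M ^ 8 * (2 * B) + 2"
        using pow len by (intro add_right_mono mult_mono) auto
      also have "\<dots> \<le> 3000 * M ^ 8 * (2 * B) + 2 * (M ^ 8 * B)"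
        using B M mult_mono[of 1 "M ^ 8" 1 B] one_le_power[of M 8] by (auto simp: mult.commute)
      \<comment> \<open>The constant is 6000 + 2, which is at most \<open>2 ^ 13\<close> and is then
        absorbed into \<open>M ^ 13\<close>; this gives the exponent 21 = 13 + 8.\<close>
      also have "\<dots> \<le> B * (2 ^ 13 * M ^ 8)"
        using B M by simp
      also have "\<dots> \<le> B * (M ^ 13 * M ^ 8)"
        using B M by (intro mult_left_mono mult_right_mono power_mono) auto
      finally show ?thesis by (simp flip: power_add)
    qed
    ultimately show ?thesis unfolding B_def M_def by blast
  qed
qed

text \<open>Program and exponent are chosen before \<open>l\<close> and the instance, so the time
  bound is uniform in \<open>l\<close>. The base \<open>max 2 n\<close> lets the polynomial factor
  absorb constants even for \<open>n \<le> 1\<close>.\<close>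

theorem lemma15:
  shows
    "(\<forall>(l::nat) (G::'a pair_pre_digraph) L H R In Out.
        l \<ge> 1 \<and> pair_graph G \<and> excellent_partition l G L H R \<and>
        In \<union> Out = H \<union> R \<and> In \<inter> Out = {} \<and>
        real (card {v \<in> R. degree G v < 10 * l}) \<le> real (card L) / 10
        \<longrightarrow> real (card {S. minimal_extension G In Out S})
              \<le> 2 powr real (card L) * 2 powr (- (real (card L) / 10)))
     \<and>
     (\<exists>(P::program) (c::nat).
        \<forall>(l::nat) (n::nat) (G::nat pair_pre_digraph) L H R In Out.
          l \<ge> 1 \<and> pair_graph G \<and> pverts G = {0..<n} \<and> excellent_partition l G L H R \<and>
          In \<union> Out = H \<union> R \<and> In \<inter> Out = {} \<and>
          real (card {v \<in> R. degree G v < 10 * l}) \<le> real (card L) / 10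
          \<longrightarrow> (\<exists>t. enumerates_in_time P n (enc_instance n G L H R In Out)
                        {S. minimal_extension G In Out S} t \<and>
                   real t \<le> 2 powr real (card L) * 2 powr (- (real (card L) / 10))
                              * real (max 2 n) ^ c))"
  by (rule conjI, (intro allI impI, elim conjE, rule card_minimal_extensions_le; assumption),
      rule exI[of _ prog], rule exI[of _ 21], intro allI impI, elim conjE,
      rule prog_enumerates; assumption)

end
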